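(* Let $k\ge 3$ and $n\ge k$ be integers. Among all $k$-uniform hypergraphs $G$ with $n$ vertices and nonempty hyperedge set, the minimum value of the tensor entropy $S(G)$ is $$S_{\min}=\ln k .$$
   Context: A $k$-uniform hypergraph $G=(V,E)$ with $n$ vertices has $V=\{1,\dots,n\}$ and $E$ a set of $k$-element subsets of $V$ (the hyperedges). Its adjacency tensor $A\in\mathbb{R}^{n\times\cdots\times n}$ (order $k$) has entries $A_{j_1\dots j_k}=\frac{1}{(k-1)!}$ if $j_1,\dots,j_k$ are distinct and $\{j_1,\dots,j_k\}\in E$, and $0$ otherwise. Its degree tensor $D$ (order $k$, dimension $n$) is diagonal, with $D_{jj\dots j}$ equal to the number of hyperedges containing vertex $j$ and all other entries $0$. The Laplacian tensor is $L=D-A$. The $k$-mode unfolding $L_{(k)}\in\mathbb{R}^{n\times n^{k-1}}$ is the matrix whose rows are indexed by $j_k$ and columns by $(j_1,\dots,j_{k-1})$, with entry $L_{j_1\dots j_k}$ (since $L$ is invariant under permutations of its indices, unfolding along any mode gives the same matrix). The $k$-mode singular values $\gamma_1,\dots,\gamma_n\ge 0$ of $L$ are the $n$ singular values of $L_{(k)}$, i.e. the square roots of the eigenvalues of $L_{(k)}L_{(k)}^\top\in\mathbb{R}^{n\times n}$, counted with multiplicity. For $E\neq\emptyset$, the tensor entropy of $G$ is $S(G)=-\sum_{j=1}^n\hat\gamma_j\ln\hat\gamma_j$, where $\hat\gamma_j=\gamma_j/\sum_{i=1}^n\gamma_i$ and $0\ln 0=0$. *)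

theory Defs
  imports Complex_Main "Jordan_Normal_Form.Char_Poly"
begin

definition uniform_hypergraph :: "nat \<Rightarrow> nat \<Rightarrow> nat set set \<Rightarrow> bool" where
  "uniform_hypergraph k n E \<longleftrightarrow> (\<forall>e\<in>E. e \<subseteq> {1..n} \<and> card e = k)"

text \<open>A tensor of order \<open>k\<close> and dimension \<open>n\<close> is represented by its entry function
  \<open>T :: nat list \<Rightarrow> real\<close>; only index lists \<open>[j\<^sub>1, \<dots>, j\<^sub>k]\<close> of length \<open>k\<close> with entries
  in \<open>{1..n}\<close> are meaningful.\<close>

definition adjacency_tensor :: "nat \<Rightarrow> nat set set \<Rightarrow> nat list \<Rightarrow> real" where
  "adjacency_tensor k E js = (if distinct js \<and> set js \<in> E then 1 / fact (k - 1) else 0)"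

definition vertex_degree :: "nat set set \<Rightarrow> nat \<Rightarrow> nat" where
  "vertex_degree E j = card {e \<in> E. j \<in> e}"

definition degree_tensor :: "nat \<Rightarrow> nat set set \<Rightarrow> nat list \<Rightarrow> real" where
  "degree_tensor k E js = (if js = replicate k (hd js) then real (vertex_degree E (hd js)) else 0)"

definition laplacian_tensor :: "nat \<Rightarrow> nat set set \<Rightarrow> nat list \<Rightarrow> real" where
  "laplacian_tensor k E js = degree_tensor k E js - adjacency_tensor k E js"

text \<open>Matrix rows and columns are numbered from 0. Row \<open>i\<close> stands for \<open>j\<^sub>k = i + 1\<close>, and
  column \<open>c\<close> for the tuple \<open>(j\<^sub>1, \<dots>, j\<^sub>k\<^sub>-\<^sub>1)\<close> with
  \<open>c = (\<Sum>t = 1..k - 1. (j\<^sub>t - 1) * n ^ (t - 1))\<close>.\<close>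

definition unfolding_column :: "nat \<Rightarrow> nat \<Rightarrow> nat \<Rightarrow> nat list" where
  "unfolding_column k n c = map (\<lambda>t. c div n ^ t mod n + 1) [0..<k - 1]"

definition k_mode_unfolding :: "nat \<Rightarrow> nat \<Rightarrow> (nat list \<Rightarrow> real) \<Rightarrow> real mat" where
  "k_mode_unfolding k n T =
     mat n (n ^ (k - 1)) (\<lambda>(i, c). T (unfolding_column k n c @ [i + 1]))"

text \<open>The eigenvalues of the symmetric matrix \<open>M M\<^sup>T\<close> are all real, so the real roots of its
  characteristic polynomial are all \<open>dim_row M\<close> eigenvalues, with multiplicity.\<close>

definition singular_values :: "real mat \<Rightarrow> real multiset" where
  "singular_values M = image_mset sqrt (proots (char_poly (M * transpose_mat M)))"

text \<open>The convention \<open>0 ln 0 = 0\<close> holds automatically.\<close>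

definition normalized_entropy :: "real multiset \<Rightarrow> real" where
  "normalized_entropy \<Gamma> =
     - (\<Sum>\<gamma>\<in>#\<Gamma>. (\<gamma> / sum_mset \<Gamma>) * ln (\<gamma> / sum_mset \<Gamma>))"

definition tensor_entropy :: "nat \<Rightarrow> nat \<Rightarrow> nat set set \<Rightarrow> real" where
  "tensor_entropy k n E =
     normalized_entropy (singular_values (k_mode_unfolding k n (laplacian_tensor k E)))"

end

theory Submission
  imports Defs "Jordan_Normal_Form.Schur_Decomposition" "HOL-Combinatorics.Multiset_Permutations"
begin

text \<open>Let \<open>u\<^sub>1, \<dots>, u\<^sub>n\<close> be an orthonormal eigenbasis of \<open>L L\<^sup>T\<close>, so that \<open>\<gamma>\<^sub>j = \<parallel>L\<^sup>T u\<^sub>j\<parallel>\<close>. Call a column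
  private to the row \<open>v\<close> if \<open>v\<close> is the only row with a nonzero entry in it, and let \<open>p\<^sub>v\<close> be the
  norm of row \<open>v\<close> restricted to its private columns. Then
  \<open>\<gamma>\<^sub>j\<^sup>2 \<ge> \<Sum>\<^sub>v p\<^sub>v\<^sup>2 u\<^sub>j\<^sub>v\<^sup>2 \<ge> (\<Sum>\<^sub>v p\<^sub>v u\<^sub>j\<^sub>v\<^sup>2)\<^sup>2\<close>, and summing over \<open>j\<close> gives \<open>\<Sum>\<^sub>j \<gamma>\<^sub>j \<ge> \<Sum>\<^sub>v p\<^sub>v\<close>.

  The diagonal column of \<open>v\<close> is private, so \<open>p\<^sub>v \<ge> d\<^sub>v\<close>; if \<open>v\<close> lies in all \<open>m\<close> edges, every nonzero
  entry of its row is private, so \<open>p\<^sub>v\<^sup>2 = m\<^sup>2 + m / (k - 1)!\<close>. As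
  \<open>\<Sum>\<^sub>j \<gamma>\<^sub>j\<^sup>2 = \<Sum>\<^sub>v (d\<^sub>v\<^sup>2 + d\<^sub>v / (k - 1)!)\<close> and \<open>\<Sum>\<^sub>v d\<^sub>v = k m\<close>, this yields \<open>k \<Sum>\<^sub>j \<gamma>\<^sub>j\<^sup>2 \<le> (\<Sum>\<^sub>j \<gamma>\<^sub>j)\<^sup>2\<close>,
  that is, the collision entropy, which is at most the Shannon entropy, is at least \<open>ln k\<close>. For a
  single edge \<open>L L\<^sup>T\<close> is diagonal with \<open>k\<close> equal nonzero entries.\<close>

section \<open>Spectral theorem for real symmetric matrices\<close>

text \<open>A complex eigenpair \<open>z\<close>, \<open>w\<close> exists by algebraic closedness.
  Symmetry makes the Hermitian form of \<open>w\<close> real, which forces \<open>z\<close> to be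
  real; it is then a root of the real characteristic polynomial and has a real eigenvector.\<close>

lemma symmetric_real_eigenvector:
  fixes A :: "real mat"
  assumes A: "A \<in> carrier_mat n n" and sym: "transpose_mat A = A" and n: "n > 0"
  obtains e v where "v \<in> carrier_vec n" "v \<noteq> 0\<^sub>v n" "A *\<^sub>v v = e \<cdot>\<^sub>v v"
proof -
  let ?C = "map_mat complex_of_real A"
  have C: "?C \<in> carrier_mat n n" using A by auto
  obtain zs where zs: "char_poly ?C = (\<Prod>a\<leftarrow>zs. [:- a, 1:])" "length zs = n"
    using char_poly_factorized[OF C] by auto
  then obtain z zs' where zs': "zs = z # zs'" using n by (cases zs) auto
  have root: "poly (char_poly ?C) z = 0" unfolding zs zs' by simp
  then obtain w where w: "w \<in> carrier_vec n" "w \<noteq> 0\<^sub>v n" "?C *\<^sub>v w = z \<cdot>\<^sub>v w"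
    using eigenvalue_root_char_poly[OF C] A unfolding eigenvalue_def eigenvector_def by auto
  have Aij: "A $$ (i,j) = A $$ (j,i)" if "i < n" "j < n" for i j
    using arg_cong[OF sym, of "\<lambda>M. M $$ (i,j)"] A that by simp
  have eq: "(\<Sum>j<n. of_real (A $$ (i,j)) * w $ j) = z * w $ i" if "i < n" for i
    using arg_cong[OF w(3), of "\<lambda>x. x $ i"] that A w(1)
    by (simp add: scalar_prod_def lessThan_atLeast0 row_def)
  \<comment> \<open>The squared norm of \<open>w\<close>. The form in fact \<open>1\<close> equals
    \<open>z * ?q\<close> and is invariant under conjugation, so \<open>z\<close> is real once
    \<open>?q\<close> is known to be nonzero.\<close>
  let ?q = "\<Sum>i<n. cnj (w $ i) * w $ i"
  have 1: "(\<Sum>i<n. \<Sum>j<n. cnj (w $ i) * (of_real (A $$ (i,j)) * w $ j)) = z * ?q"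
    unfolding sum_distrib_left[symmetric]
    by (subst sum_distrib_left, rule sum.cong) (simp_all add: eq)
  have "cnj (z * ?q) = (\<Sum>i<n. \<Sum>j<n. w $ i * (of_real (A $$ (i,j)) * cnj (w $ j)))"
    unfolding 1[symmetric] by simp
  also have "\<dots> = (\<Sum>j<n. \<Sum>i<n. w $ i * (of_real (A $$ (i,j)) * cnj (w $ j)))"
    by (rule sum.swap)
  also have "\<dots> = z * ?q"
    unfolding 1[symmetric] by (intro sum.cong refl) (simp add: Aij)
  finally have "cnj z * ?q = z * ?q" by (simp add: mult.commute)
  moreover have "?q \<noteq> 0"
  proof
    assume "?q = 0"
    moreover have "?q = of_real (\<Sum>i<n. (cmod (w $ i))\<^sup>2)"
      unfolding of_real_sum complex_norm_square by (simp add: mult.commute)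
    ultimately have "(\<Sum>i<n. (cmod (w $ i))\<^sup>2) = 0" using of_real_eq_0_iff by metis
    then have "\<forall>i<n. w $ i = 0" by (subst (asm) sum_nonneg_eq_0_iff) auto
    then have "w = 0\<^sub>v n" using w(1) by (intro eq_vecI) auto
    with w(2) show False by simp
  qed
  ultimately have "cnj z = z" by simp
  then have z: "z = of_real (Re z)" by (simp add: complex_eq_iff)
  have "of_real (poly (char_poly A) (Re z)) = poly (char_poly ?C) z"
    unfolding of_real_hom.char_poly_hom[OF A] by (subst (2) z) simp
  then have "poly (char_poly A) (Re z) = 0" using root by simp
  then obtain v where "v \<in> carrier_vec n" "v \<noteq> 0\<^sub>v n" "A *\<^sub>v v = Re z \<cdot>\<^sub>v v"
    using eigenvalue_root_char_poly[OF A] A unfolding eigenvalue_def eigenvector_def by auto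
  then show thesis using that by blast
qed

text \<open>Gram-Schmidt leaves the first vector of a basis unchanged, so starting from a completion
  of \<open>v\<close> and normalizing the columns gives an orthogonal matrix whose first column is
  parallel to \<open>v\<close>.\<close>

lemma orthogonal_extension:
  fixes v :: "real vec"
  assumes v: "v \<in> carrier_vec n" and v0: "v \<noteq> 0\<^sub>v n" and n: "n > 0"
  obtains W c where "W \<in> carrier_mat n n" "transpose_mat W * W = 1\<^sub>m n" "col W 0 = c \<cdot>\<^sub>v v"
proof -
  interpret cof_vec_space n "TYPE(real)" .
  define b where "b = basis_completion v"
  define ws where "ws = gram_schmidt n b"
  from basis_completion[OF v v0, folded b_def]
  have dist_b: "distinct b" and indep: "\<not> lin_dep (set b)" and b: "set b \<subseteq> carrier_vec n"
    and hdb: "hd b = v" and len_b: "length b = n" by auto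
  from hdb len_b n obtain vs where bv: "b = v # vs" by (cases b) auto
  from gram_schmidt_result[OF b dist_b indep refl, folded ws_def]
  have ws: "set ws \<subseteq> carrier_vec n" "corthogonal ws" "length ws = n"
    by (auto simp: len_b)
  from gram_schmidt_hd[OF v, of vs, folded bv] have hdws: "hd ws = v" unfolding ws_def .
  have dim: "ws ! j \<in> carrier_vec n" if "j < n" for j using ws that by auto
  \<comment> \<open>Gram-Schmidt is stated for conjugate orthogonality, which over the reals is
    plain orthogonality.\<close>
  have conj: "conjugate x = x" for x :: "real vec" by (intro eq_vecI) auto
  have orth: "ws ! i \<bullet> ws ! j = 0 \<longleftrightarrow> i \<noteq> j" if "i < n" "j < n" for i j
    using ws(2,3) that unfolding corthogonal_def conj by auto
  define r where "r j = sqrt (ws ! j \<bullet> ws ! j)" for j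
  have pos: "ws ! j \<bullet> ws ! j > 0" if "j < n" for j
  proof -
    have "ws ! j \<bullet> ws ! j \<ge> 0" by (auto simp: scalar_prod_def intro!: sum_nonneg)
    then show ?thesis using orth[OF that that] by simp
  qed
  then have r: "r j \<noteq> 0" "r j * r j = ws ! j \<bullet> ws ! j" if "j < n" for j
    using that by (simp_all add: r_def less_imp_le less_imp_neq[symmetric])
  define W where "W = mat n n (\<lambda>(i,j). ws ! j $ i / r j)"
  have W: "W \<in> carrier_mat n n" by (simp add: W_def)
  have colW: "col W j = (1 / r j) \<cdot>\<^sub>v (ws ! j)" if "j < n" for j
    using that dim[OF that] by (intro eq_vecI) (auto simp: W_def)
  have "transpose_mat W * W = 1\<^sub>m n"
  proof (rule eq_matI)
    fix i j assume "i < dim_row (1\<^sub>m n :: real mat)" "j < dim_col (1\<^sub>m n :: real mat)"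
    then have ij: "i < n" "j < n" by auto
    then have "(transpose_mat W * W) $$ (i,j) = col W i \<bullet> col W j" using W by auto
    also have "\<dots> = (ws ! i \<bullet> ws ! j) / (r i * r j)"
      using dim[OF ij(1)] dim[OF ij(2)] by (simp add: colW ij)
    also have "\<dots> = 1\<^sub>m n $$ (i,j)"
      using ij orth[OF ij] r[OF ij(1)] by (cases "i = j") auto
    finally show "(transpose_mat W * W) $$ (i,j) = 1\<^sub>m n $$ (i,j)" .
  qed (use W in auto)
  moreover have "col W 0 = (1 / r 0) \<cdot>\<^sub>v v"
    using colW[of 0] n hdws ws(3) by (metis hd_conv_nth length_greater_0_conv)
  ultimately show thesis using that W by blast
qed

text \<open>Deflation: in an orthonormal basis starting with an eigenvector the first column of the
  matrix is a multiple of the first unit vector, and by symmetry so is the first row. The induction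
  hypothesis diagonalizes the remaining block.\<close>

theorem symmetric_real_diagonalization:
  fixes A :: "real mat"
  assumes "A \<in> carrier_mat n n" and "transpose_mat A = A"
  shows "\<exists>U f. U \<in> carrier_mat n n \<and> transpose_mat U * U = 1\<^sub>m n \<and>
    A = U * mat_diag n f * transpose_mat U"
  using assms
proof (induction n arbitrary: A)
  case 0
  then show ?case by (intro exI[of _ "1\<^sub>m 0"]) (auto intro!: eq_matI)
next
  case (Suc m)
  let ?n = "Suc m"
  note A = Suc.prems(1)
  obtain e v where v: "v \<in> carrier_vec ?n" "v \<noteq> 0\<^sub>v ?n" "A *\<^sub>v v = e \<cdot>\<^sub>v v"
    using symmetric_real_eigenvector[OF Suc.prems] by blast
  obtain W c where W: "W \<in> carrier_mat ?n ?n" and WW: "transpose_mat W * W = 1\<^sub>m ?n"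
    and W0: "col W 0 = c \<cdot>\<^sub>v v"
    using orthogonal_extension[OF v(1,2)] by blast
  have WT: "transpose_mat W \<in> carrier_mat ?n ?n" using W by simp
  have WW': "W * transpose_mat W = 1\<^sub>m ?n"
    using mat_mult_left_right_inverse[OF WT W WW] .
  define B where "B = transpose_mat W * (A * W)"
  have AW: "A * W \<in> carrier_mat ?n ?n" using A W by auto
  have B: "B \<in> carrier_mat ?n ?n" using AW WT by (simp add: B_def)
  have "transpose_mat B = transpose_mat (A * W) * W"
    unfolding B_def using transpose_mult[OF WT AW] by simp
  also have "\<dots> = transpose_mat W * A * W" using transpose_mult[OF A W] Suc.prems(2) by simp
  also have "\<dots> = B" unfolding B_def using assoc_mult_mat[OF WT A W] by simp
  finally have symB: "transpose_mat B = B" .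
  have Bij: "B $$ (i,j) = B $$ (j,i)" if "i < ?n" "j < ?n" for i j
    using arg_cong[OF symB, of "\<lambda>M. M $$ (i,j)"] B that by simp
  have "col (A * W) 0 = A *\<^sub>v col W 0" using A W by (intro eq_vecI) auto
  also have "\<dots> = e \<cdot>\<^sub>v col W 0"
    unfolding W0 using v(1) A by (simp add: mult_mat_vec[OF A v(1)] v(3) smult_smult_assoc mult.commute)
  finally have col0: "col (A * W) 0 = e \<cdot>\<^sub>v col W 0" .
  have B0: "B $$ (i,0) = (if i = 0 then e else 0)" if "i < ?n" for i
  proof -
    have "B $$ (i,0) = col W i \<bullet> col (A * W) 0" unfolding B_def using that W AW by auto
    also have "\<dots> = e * (col W i \<bullet> col W 0)" unfolding col0 using W by simp
    also have "col W i \<bullet> col W 0 = (transpose_mat W * W) $$ (i,0)" using that W by auto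
    also have "\<dots> = (if i = 0 then 1 else 0)" unfolding WW using that by simp
    finally show ?thesis by simp
  qed
  define B3 where "B3 = mat m m (\<lambda>(i,j). B $$ (Suc i, Suc j))"
  have B3: "B3 \<in> carrier_mat m m" by (simp add: B3_def)
  have "transpose_mat B3 = B3" by (intro eq_matI) (auto simp: B3_def Bij)
  from Suc.IH[OF B3 this] obtain V f where V: "V \<in> carrier_mat m m"
    and VV: "transpose_mat V * V = 1\<^sub>m m" and B3V: "B3 = V * mat_diag m f * transpose_mat V" by blast
  \<comment> \<open>The diagonalizer \<open>V\<close> of the smaller block, extended by the identity
    on the eigenvector already split off; \<open>W * F\<close> will be the final change of
    basis.\<close>
  define F where "F = four_block_mat (1\<^sub>m 1) (0\<^sub>m 1 m) (0\<^sub>m m 1) V"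
  have FT: "transpose_mat F = four_block_mat (1\<^sub>m 1) (0\<^sub>m 1 m) (0\<^sub>m m 1) (transpose_mat V)"
    unfolding F_def using transpose_four_block_mat[of "1\<^sub>m 1" 1 1 "0\<^sub>m 1 m" m "0\<^sub>m m 1" m V] V
    by (simp add: transpose_one)
  have F: "F \<in> carrier_mat ?n ?n" using V unfolding F_def
    by (metis four_block_carrier_mat one_carrier_mat plus_1_eq_Suc)
  have FTc: "transpose_mat F \<in> carrier_mat ?n ?n" using F by simp
  have VT: "transpose_mat V \<in> carrier_mat m m" using V by simp
  have FF: "transpose_mat F * F = 1\<^sub>m ?n"
    unfolding FT unfolding F_def
    by (subst mult_four_block_mat[of _ 1 1 _ m _ m _ _ 1 _ m]) (use V VT VV in auto)
  define g where "g = case_nat e f"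
  have diag: "mat_diag ?n g = four_block_mat (mat_diag 1 (\<lambda>_. e)) (0\<^sub>m 1 m) (0\<^sub>m m 1) (mat_diag m f)"
    by (intro eq_matI) (auto simp: mat_diag_def g_def four_block_mat_def Let_def split: nat.splits)
  have "F * mat_diag ?n g * transpose_mat F
      = four_block_mat (mat_diag 1 (\<lambda>_. e)) (0\<^sub>m 1 m) (0\<^sub>m m 1) B3"
    unfolding FT unfolding F_def diag B3V
    using V VT mult_carrier_mat[OF V mat_diag_dim[of m f]]
    by (simp add: mult_four_block_mat[of _ 1 1 _ m _ m _ _ 1 _ m] left_mult_zero_mat[OF mat_diag_dim]
        left_mult_one_mat[OF mat_diag_dim] right_mult_one_mat[OF mat_diag_dim]
        right_mult_zero_mat[OF mat_diag_dim] right_mult_zero_mat[OF mult_carrier_mat[OF V mat_diag_dim]] right_add_zero_mat[OF mat_diag_dim]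
        left_add_zero_mat[OF mult_carrier_mat[OF mult_carrier_mat[OF V mat_diag_dim] VT]] del: One_nat_def)
  also have "\<dots> = B"
    using B by (intro eq_matI)
      (auto simp: B3_def four_block_mat_def Let_def mat_diag_def B0 Bij[of 0] less_Suc_eq_0_disj)
  finally have FB: "F * mat_diag ?n g * transpose_mat F = B" .
  let ?U = "W * F"
  have U: "?U \<in> carrier_mat ?n ?n" using W F by auto
  have UT: "transpose_mat ?U = transpose_mat F * transpose_mat W" using transpose_mult[OF W F] .
  have "transpose_mat ?U * ?U = transpose_mat F * (transpose_mat W * W * F)"
    unfolding UT using FTc WT W F by (simp add: assoc_mult_mat[where n\<^sub>4="?n"])
  also have "\<dots> = 1\<^sub>m ?n" unfolding WW using F FF by simp
  finally have UU: "transpose_mat ?U * ?U = 1\<^sub>m ?n" .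
  have D: "mat_diag ?n g \<in> carrier_mat ?n ?n" by simp
  have FD: "F * mat_diag ?n g \<in> carrier_mat ?n ?n" using F by auto
  have "?U * mat_diag ?n g * transpose_mat ?U = W * (F * mat_diag ?n g) * (transpose_mat F * transpose_mat W)"
    unfolding UT using assoc_mult_mat[OF W F D] by simp
  also have "\<dots> = W * B * transpose_mat W"
    unfolding FB[symmetric]
    using assoc_mult_mat[OF W FD FTc] assoc_mult_mat[OF _ FTc WT, of "W * (F * mat_diag ?n g)" ?n] W FD by simp
  also have "\<dots> = W * transpose_mat W * (A * W) * transpose_mat W"
    unfolding B_def using assoc_mult_mat[OF W WT AW] by simp
  also have "\<dots> = A * (W * transpose_mat W)" by (simp only: WW' left_mult_one_mat[OF AW] assoc_mult_mat[OF A W WT])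
  also have "\<dots> = A" unfolding WW' using A by simp
  finally show ?case using U UU by metis
qed

section \<open>Singular values through an orthonormal eigenbasis\<close>

lemma proots_prod_linear: "proots (\<Prod>a\<leftarrow>as. [:- a, 1:] :: 'a :: idom poly) = mset as"
proof (induction as)
  case (Cons a as)
  have "(\<Prod>a\<leftarrow>as. [:- a, 1:]) \<noteq> 0" by (auto simp: prod_list_zero_iff)
  then have "proots ([:- a, 1:] * (\<Prod>a\<leftarrow>as. [:- a, 1:])) = {#a#} + mset as"
    by (subst proots_mult) (auto simp: Cons.IH)
  then show ?case by simp
qed simp

lemma char_poly_mat_diag: "char_poly (mat_diag n f) = (\<Prod>a\<leftarrow>map f [0..<n]. [:- a, 1:])"
proof -
  have "diag_mat (mat_diag n f) = map f [0..<n]"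
    by (auto simp: diag_mat_def mat_diag_def)
  moreover have "upper_triangular (mat_diag n f)" by (auto simp: mat_diag_def)
  ultimately show ?thesis using char_poly_upper_triangular[of "mat_diag n f" n] by simp
qed

text \<open>This replaces roots of a characteristic polynomial by norms of images of orthonormal
  vectors. Here \<open>u j\<close> is column \<open>j\<close> of the diagonalizing matrix;
  orthogonality of its rows and normalization of its columns are both recorded, since later sums run
  over either index.\<close>

lemma singular_values_orthonormal:
  assumes L: "L \<in> carrier_mat n N"
  obtains u :: "nat \<Rightarrow> nat \<Rightarrow> real" where
    "\<And>v w. v < n \<Longrightarrow> w < n \<Longrightarrow> (\<Sum>j<n. u j v * u j w) = (if v = w then 1 else 0)"
    "\<And>j. j < n \<Longrightarrow> (\<Sum>v<n. (u j v)\<^sup>2) = 1"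
    "singular_values L =
      image_mset (\<lambda>j. sqrt (\<Sum>c<N. (\<Sum>v<n. u j v * L $$ (v,c))\<^sup>2)) (mset_set {..<n})"
proof -
  let ?A = "L * transpose_mat L"
  have LT: "transpose_mat L \<in> carrier_mat N n" using L by simp
  have A: "?A \<in> carrier_mat n n" using L by simp
  have "transpose_mat ?A = ?A" using transpose_mult[OF L LT] by simp
  from symmetric_real_diagonalization[OF A this] obtain U f where
    U: "U \<in> carrier_mat n n" and UU: "transpose_mat U * U = 1\<^sub>m n"
    and AU: "?A = U * mat_diag n f * transpose_mat U" by blast
  have UT: "transpose_mat U \<in> carrier_mat n n" using U by simp
  have UU': "U * transpose_mat U = 1\<^sub>m n" using mat_mult_left_right_inverse[OF UT U UU] .
  define u where "u j v = U $$ (v,j)" for j v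
  have D: "mat_diag n f \<in> carrier_mat n n" by simp
  have "similar_mat ?A (mat_diag n f)"
    by (rule similar_matI[of _ _ U "transpose_mat U" n]) (use A U UU UU' AU in auto)
  then have "proots (char_poly ?A) = mset (map f [0..<n])"
    by (simp only: char_poly_similar char_poly_mat_diag proots_prod_linear)
  then have sv: "singular_values L = image_mset (\<lambda>j. sqrt (f j)) (mset_set {..<n})"
    unfolding singular_values_def
    by (simp add: multiset.map_comp comp_def lessThan_atLeast0 flip: mset_upt)
  \<comment> \<open>The columns of \<open>X\<close> are the images of the eigenvectors. Its Gram
    matrix is the diagonal matrix of eigenvalues, so each \<open>f j\<close> is a squared column
    norm.\<close>
  define X where "X = transpose_mat L * U"
  have X: "X \<in> carrier_mat N n" using LT U by (simp add: X_def)
  have XT: "transpose_mat X = transpose_mat U * L"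
    unfolding X_def using transpose_mult[OF LT U] by simp
  have UTL: "transpose_mat U * L \<in> carrier_mat n N" using UT L by simp
  have UTU: "transpose_mat U * (U * mat_diag n f) = mat_diag n f"
    using assoc_mult_mat[OF UT U D] UU left_mult_one_mat[OF D] by simp
  have "transpose_mat X * X = transpose_mat U * ?A * U"
    unfolding XT unfolding X_def
    using assoc_mult_mat[OF UTL LT U] assoc_mult_mat[OF UT L LT] by simp
  also have "\<dots> = mat_diag n f * (transpose_mat U * U)"
    unfolding AU
    using assoc_mult_mat[OF UT mult_carrier_mat[OF U D] UT] assoc_mult_mat[OF D UT U] UTU by simp
  also have "\<dots> = mat_diag n f" unfolding UU by (simp add: right_mult_one_mat[OF D])
  finally have XX: "transpose_mat X * X = mat_diag n f" .
  have f: "f j = (\<Sum>c<N. (\<Sum>v<n. u j v * L $$ (v,c))\<^sup>2)" if j: "j < n" for j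
  proof -
    have "f j = (transpose_mat X * X) $$ (j,j)" unfolding XX using j by (simp add: mat_diag_def)
    also have "\<dots> = (\<Sum>c<N. (X $$ (c,j))\<^sup>2)"
      using X j by (simp add: scalar_prod_def lessThan_atLeast0 power2_eq_square)
    also have "\<dots> = (\<Sum>c<N. (\<Sum>v<n. u j v * L $$ (v,c))\<^sup>2)"
      using L U j by (simp add: X_def u_def scalar_prod_def lessThan_atLeast0 mult.commute)
    finally show ?thesis .
  qed
  show thesis
  proof
    show "(\<Sum>j<n. u j v * u j w) = (if v = w then 1 else 0)" if "v < n" "w < n" for v w
    proof -
      have "(\<Sum>j<n. u j v * u j w) = (U * transpose_mat U) $$ (v,w)"
        using U that by (simp add: u_def scalar_prod_def lessThan_atLeast0)
      then show ?thesis unfolding UU' using that by simp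
    qed
    show "(\<Sum>v<n. (u j v)\<^sup>2) = 1" if "j < n" for j
    proof -
      have "(\<Sum>v<n. (u j v)\<^sup>2) = (transpose_mat U * U) $$ (j,j)"
        using U that by (simp add: u_def scalar_prod_def lessThan_atLeast0 power2_eq_square)
      then show ?thesis unfolding UU using that by simp
    qed
    show "singular_values L =
      image_mset (\<lambda>j. sqrt (\<Sum>c<N. (\<Sum>v<n. u j v * L $$ (v,c))\<^sup>2)) (mset_set {..<n})"
      unfolding sv by (intro image_mset_cong) (simp add: f)
  qed
qed

lemma singular_values_nonneg:
  assumes "L \<in> carrier_mat n N" and "\<gamma> \<in># singular_values L"
  shows "\<gamma> \<ge> 0"
  using assms(2) by (rule_tac singular_values_orthonormal[OF assms(1)]) (auto intro!: sum_nonneg)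

text \<open>Parseval in each column: after expanding the squares, the orthogonality relations remove
  all mixed terms. The total is the squared Frobenius norm.\<close>

lemma sum_singular_values_squared:
  assumes "L \<in> carrier_mat n N"
  shows "(\<Sum>\<gamma>\<in>#singular_values L. \<gamma>\<^sup>2) = (\<Sum>v<n. \<Sum>c<N. (L $$ (v,c))\<^sup>2)"
proof -
  obtain u :: "nat \<Rightarrow> nat \<Rightarrow> real" where
    u: "\<And>v w. v < n \<Longrightarrow> w < n \<Longrightarrow> (\<Sum>j<n. u j v * u j w) = (if v = w then 1 else 0)"
    and sv: "singular_values L =
      image_mset (\<lambda>j. sqrt (\<Sum>c<N. (\<Sum>v<n. u j v * L $$ (v,c))\<^sup>2)) (mset_set {..<n})"
    by (rule singular_values_orthonormal[OF assms]) blast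
  have "(\<Sum>\<gamma>\<in>#singular_values L. \<gamma>\<^sup>2) = (\<Sum>j<n. \<Sum>c<N. (\<Sum>v<n. u j v * L $$ (v,c))\<^sup>2)"
    unfolding sv by (simp add: multiset.map_comp comp_def sum_nonneg flip: sum_unfold_sum_mset)
  also have "\<dots> = (\<Sum>c<N. \<Sum>j<n. (\<Sum>v<n. u j v * L $$ (v,c))\<^sup>2)" by (rule sum.swap)
  also have "\<dots> = (\<Sum>c<N. \<Sum>v<n. (L $$ (v,c))\<^sup>2)"
  proof (rule sum.cong)
    fix c
    have "(\<Sum>j<n. (\<Sum>v<n. u j v * L $$ (v,c))\<^sup>2)
        = (\<Sum>j<n. \<Sum>v<n. \<Sum>w<n. (L $$ (v,c) * L $$ (w,c)) * (u j v * u j w))"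
      by (simp add: power2_eq_square sum_product mult_ac)
    also have "\<dots> = (\<Sum>v<n. \<Sum>w<n. \<Sum>j<n. (L $$ (v,c) * L $$ (w,c)) * (u j v * u j w))"
      by (subst sum.swap) (intro sum.cong refl sum.swap)
    also have "\<dots> = (\<Sum>v<n. \<Sum>w<n. (L $$ (v,c) * L $$ (w,c)) * (if v = w then 1 else 0))"
      unfolding sum_distrib_left[symmetric] by (intro sum.cong refl) (simp add: u)
    also have "\<dots> = (\<Sum>v<n. (L $$ (v,c))\<^sup>2)"
      by (intro sum.cong refl) (simp add: power2_eq_square if_distrib[of "(*) _"] cong: if_cong)
    finally show "(\<Sum>j<n. (\<Sum>v<n. u j v * L $$ (v,c))\<^sup>2) = (\<Sum>v<n. (L $$ (v,c))\<^sup>2)" .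
  qed simp
  also have "\<dots> = (\<Sum>v<n. \<Sum>c<N. (L $$ (v,c))\<^sup>2)" by (rule sum.swap)
  finally show ?thesis .
qed

section \<open>Private columns and the sum of the singular values\<close>

text \<open>Demanding a nonzero entry keeps the sets of different rows disjoint; a zero column would
  otherwise belong to all of them.\<close>

definition private_columns :: "real mat \<Rightarrow> nat \<Rightarrow> nat set" where
  "private_columns L v =
    {c. c < dim_col L \<and> L $$ (v,c) \<noteq> 0 \<and> (\<forall>u<dim_row L. u \<noteq> v \<longrightarrow> L $$ (u,c) = 0)}"

text \<open>On a column private to \<open>v\<close> the inner sum reduces to its \<open>v\<close>
  term. These columns are disjoint for different rows, and all other columns contribute nonnegative
  squares.\<close>

lemma sum_square_ge_private:
  assumes L: "L \<in> carrier_mat n N"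
  shows "(\<Sum>v<n. (x v)\<^sup>2 * (\<Sum>c\<in>private_columns L v. (L $$ (v,c))\<^sup>2))
    \<le> (\<Sum>c<N. (\<Sum>v<n. x v * L $$ (v,c))\<^sup>2)"
proof -
  let ?P = "private_columns L"
  have P: "?P v \<subseteq> {..<N}" for v using L by (auto simp: private_columns_def)
  then have fin: "finite (?P v)" for v by (rule finite_subset) simp
  have row: "(\<Sum>v<n. x v * L $$ (v,c)) = x v * L $$ (v,c)" if "c \<in> ?P v" "v < n" for c v
  proof -
    have "(\<Sum>w<n. x w * L $$ (w,c)) = (\<Sum>w\<in>{v}. x w * L $$ (w,c))"
      by (rule sum.mono_neutral_right) (use that L in \<open>auto simp: private_columns_def\<close>)
    then show ?thesis by simp
  qed
  have "(\<Sum>v<n. (x v)\<^sup>2 * (\<Sum>c\<in>?P v. (L $$ (v,c))\<^sup>2))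
      = (\<Sum>v<n. \<Sum>c\<in>?P v. (\<Sum>w<n. x w * L $$ (w,c))\<^sup>2)"
    unfolding sum_distrib_left by (intro sum.cong refl) (simp add: row power_mult_distrib)
  also have "\<dots> = (\<Sum>c\<in>(\<Union>v<n. ?P v). (\<Sum>w<n. x w * L $$ (w,c))\<^sup>2)"
    by (rule sum.UNION_disjoint[symmetric]) (use fin L in \<open>auto simp: private_columns_def\<close>)
  also have "\<dots> \<le> (\<Sum>c<N. (\<Sum>v<n. x v * L $$ (v,c))\<^sup>2)"
    by (rule sum_mono2) (use P in auto)
  finally show ?thesis .
qed

text \<open>The variance of \<open>p\<close> under the probability weights \<open>w\<close> is
  nonnegative.\<close>

lemma weighted_mean_square_le:
  fixes p w :: "nat \<Rightarrow> real"
  assumes w: "\<And>v. v < n \<Longrightarrow> w v \<ge> 0" and w1: "(\<Sum>v<n. w v) = 1"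
  shows "(\<Sum>v<n. p v * w v)\<^sup>2 \<le> (\<Sum>v<n. (p v)\<^sup>2 * w v)"
proof -
  let ?\<mu> = "\<Sum>v<n. p v * w v"
  have "0 \<le> (\<Sum>v<n. w v * (p v - ?\<mu>)\<^sup>2)" using w by (intro sum_nonneg) auto
  also have "\<dots> = (\<Sum>v<n. (p v)\<^sup>2 * w v - 2 * ?\<mu> * (p v * w v) + ?\<mu>\<^sup>2 * w v)"
    by (intro sum.cong refl) (simp add: power2_diff algebra_simps)
  also have "\<dots> = (\<Sum>v<n. (p v)\<^sup>2 * w v) - 2 * ?\<mu> * ?\<mu> + ?\<mu>\<^sup>2 * (\<Sum>v<n. w v)"
    by (simp only: sum.distrib sum_subtractf sum_distrib_left)
  finally show ?thesis by (simp add: w1 power2_eq_square)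
qed

text \<open>The squares of the entries \<open>u j v\<close> sum to one over \<open>v\<close> and
  over \<open>j\<close>. The first fact makes them weights for the mean square inequality at fixed
  \<open>j\<close>; the second gives each \<open>p v\<close> total weight one after summing over
  \<open>j\<close>.\<close>

lemma sum_singular_values_ge:
  assumes L: "L \<in> carrier_mat n N"
    and p: "\<And>v. v < n \<Longrightarrow> (p v)\<^sup>2 \<le> (\<Sum>c\<in>private_columns L v. (L $$ (v,c))\<^sup>2)"
  shows "(\<Sum>v<n. p v) \<le> sum_mset (singular_values L)"
proof -
  obtain u :: "nat \<Rightarrow> nat \<Rightarrow> real" where
    u: "\<And>v w. v < n \<Longrightarrow> w < n \<Longrightarrow> (\<Sum>j<n. u j v * u j w) = (if v = w then 1 else 0)"
    and u1: "\<And>j. j < n \<Longrightarrow> (\<Sum>v<n. (u j v)\<^sup>2) = 1"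
    and sv: "singular_values L =
      image_mset (\<lambda>j. sqrt (\<Sum>c<N. (\<Sum>v<n. u j v * L $$ (v,c))\<^sup>2)) (mset_set {..<n})"
    by (rule singular_values_orthonormal[OF L]) blast
  have "(\<Sum>v<n. p v) = (\<Sum>v<n. p v * (\<Sum>j<n. (u j v)\<^sup>2))"
    using u by (simp add: power2_eq_square)
  also have "\<dots> = (\<Sum>j<n. \<Sum>v<n. p v * (u j v)\<^sup>2)"
    unfolding sum_distrib_left by (rule sum.swap)
  also have "\<dots> \<le> (\<Sum>j<n. sqrt (\<Sum>c<N. (\<Sum>v<n. u j v * L $$ (v,c))\<^sup>2))"
  proof (rule sum_mono, rule real_le_rsqrt)
    fix j assume "j \<in> {..<n}"
    then have "(\<Sum>v<n. p v * (u j v)\<^sup>2)\<^sup>2 \<le> (\<Sum>v<n. (p v)\<^sup>2 * (u j v)\<^sup>2)"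
      by (intro weighted_mean_square_le) (auto simp: u1)
    also have "\<dots> \<le> (\<Sum>v<n. (u j v)\<^sup>2 * (\<Sum>c\<in>private_columns L v. (L $$ (v,c))\<^sup>2))"
      using p by (intro sum_mono) (simp add: mult.commute[of "(p _)\<^sup>2"] mult_left_mono)
    also have "\<dots> \<le> (\<Sum>c<N. (\<Sum>v<n. u j v * L $$ (v,c))\<^sup>2)"
      by (rule sum_square_ge_private[OF L])
    finally show "(\<Sum>v<n. p v * (u j v)\<^sup>2)\<^sup>2 \<le> (\<Sum>c<N. (\<Sum>v<n. u j v * L $$ (v,c))\<^sup>2)" .
  qed
  also have "\<dots> = sum_mset (singular_values L)"
    unfolding sv by (simp flip: sum_unfold_sum_mset)
  finally show ?thesis .
qed

section \<open>Entropy bounded below by the second moment\<close>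

lemma sum_mset_diff_distrib:
  fixes f g :: "'a \<Rightarrow> 'b :: ab_group_add"
  shows "(\<Sum>x\<in>#M. f x - g x) = (\<Sum>x\<in>#M. f x) - (\<Sum>x\<in>#M. g x)"
  by (induction M) (simp_all add: algebra_simps)

text \<open>Instead of Jensen's inequality for the logarithm, its tangent at \<open>1 / k\<close> is
  used: it bounds each entropy term by a quadratic polynomial, whose sum involves only the first two
  power sums.\<close>

lemma normalized_entropy_ge:
  assumes nonneg: "\<And>\<gamma>. \<gamma> \<in># \<Gamma> \<Longrightarrow> \<gamma> \<ge> 0" and pos: "sum_mset \<Gamma> > 0" and k: "k > 0"
    and coll: "k * (\<Sum>\<gamma>\<in>#\<Gamma>. \<gamma>\<^sup>2) \<le> (sum_mset \<Gamma>)\<^sup>2"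
  shows "ln k \<le> normalized_entropy \<Gamma>"
proof -
  define S where "S = sum_mset \<Gamma>"
  have S: "S > 0" "(\<Sum>\<gamma>\<in>#\<Gamma>. \<gamma>) = S" using pos by (simp_all add: S_def)
  \<comment> \<open>The right side is \<open>k * q^2 - (1 + ln k) * q\<close> for
    \<open>q = \<gamma> / S\<close>. Both sides vanish at \<open>\<gamma> = 0\<close>.\<close>
  have *: "(\<gamma> / S) * ln (\<gamma> / S) \<le> (k / S\<^sup>2) * \<gamma>\<^sup>2 - ((1 + ln k) / S) * \<gamma>" if "\<gamma> \<in># \<Gamma>" for \<gamma>
  proof (cases "\<gamma> = 0")
    case False
    then have g: "\<gamma> > 0" using nonneg[OF that] by simp
    define q where "q = \<gamma> / S"
    have q: "q > 0" using g S by (simp add: q_def)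
    have "ln (k * q) \<le> k * q - 1" using q k by (intro ln_le_minus_one) simp
    then have "ln q \<le> k * q - 1 - ln k" using q k by (simp add: ln_mult)
    then have "q * ln q \<le> q * (k * q - 1 - ln k)" using q by (intro mult_left_mono) auto
    also have "\<dots> = k * q\<^sup>2 - (1 + ln k) * q" by (simp add: algebra_simps power2_eq_square)
    finally show ?thesis by (simp add: q_def power_divide)
  qed simp
  define Q where "Q = (\<Sum>\<gamma>\<in>#\<Gamma>. \<gamma>\<^sup>2)"
  have "(\<Sum>\<gamma>\<in>#\<Gamma>. (\<gamma> / S) * ln (\<gamma> / S)) \<le> (\<Sum>\<gamma>\<in>#\<Gamma>. (k / S\<^sup>2) * \<gamma>\<^sup>2 - ((1 + ln k) / S) * \<gamma>)"
    by (rule sum_mset_mono) (rule *)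
  also have "\<dots> = (k / S\<^sup>2) * Q - ((1 + ln k) / S) * (\<Sum>\<gamma>\<in>#\<Gamma>. \<gamma>)"
    by (simp only: Q_def sum_mset_diff_distrib sum_mset_distrib_left)
  also have "\<dots> = k * Q / S\<^sup>2 - (1 + ln k)" unfolding S(2) using S(1) by simp
  also have "\<dots> \<le> 1 - (1 + ln k)" using coll[folded Q_def S_def] S(1) by simp
  finally show ?thesis unfolding normalized_entropy_def S_def[symmetric] by simp
qed

section \<open>Entries and private columns of the unfolded Laplacian\<close>

text \<open>The list consists of the base \<open>n\<close> digits of \<open>c\<close>, lowest first,
  shifted by one. Injectivity follows by splitting off the lowest digit.\<close>

lemma bij_betw_digits:
  fixes n m :: nat
  assumes n: "n > 0"
  shows "bij_betw (\<lambda>c. map (\<lambda>t. c div n ^ t mod n + 1) [0..<m]) {..<n ^ m}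
    {xs. set xs \<subseteq> {1..n} \<and> length xs = m}"
proof -
  let ?f = "\<lambda>m c. map (\<lambda>t. c div n ^ t mod n + 1) [0..<m]"
  have step: "?f (Suc m) c = (c mod n + 1) # ?f m (c div n)" for m c
    by (simp add: upt_conv_Cons map_Suc_upt[symmetric] comp_def div_mult2_eq del: upt_Suc)
  have inj: "inj_on (?f m) {..<n ^ m}"
  proof (induction m)
    case (Suc m)
    show ?case
    proof (rule inj_onI)
      fix c c' assume c: "c \<in> {..<n ^ Suc m}" "c' \<in> {..<n ^ Suc m}"
        and eq: "?f (Suc m) c = ?f (Suc m) c'"
      have "c div n \<in> {..<n ^ m}" "c' div n \<in> {..<n ^ m}"
        using c n by (auto simp: less_mult_imp_div_less mult.commute)
      moreover have "?f m (c div n) = ?f m (c' div n)" using eq unfolding step by simp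
      ultimately have "c div n = c' div n" using Suc.IH by (simp add: inj_on_def)
      moreover have "c mod n = c' mod n" using eq unfolding step by simp
      ultimately show "c = c'" by (metis div_mult_mod_eq)
    qed
  qed (simp add: inj_on_def)
  \<comment> \<open>Surjectivity comes from counting: both sets have \<open>n ^ m\<close>
    elements.\<close>
  have "?f m ` {..<n ^ m} = {xs. set xs \<subseteq> {1..n} \<and> length xs = m}"
  proof (rule card_subset_eq)
    show "?f m ` {..<n ^ m} \<subseteq> {xs. set xs \<subseteq> {1..n} \<and> length xs = m}"
      using n by (auto simp: Suc_le_eq)
    show "card (?f m ` {..<n ^ m}) = card {xs. set xs \<subseteq> {1..n} \<and> length xs = m}"
      unfolding card_image[OF inj] by (simp add: card_lists_length_eq)
  qed (simp add: finite_lists_length_eq)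
  with inj show ?thesis by (simp add: bij_betw_def)
qed

context
  fixes k n :: nat and E :: "nat set set"
  assumes k: "k \<ge> 3" and kn: "n \<ge> k" and E: "uniform_hypergraph k n E"
begin

private abbreviation "index_lists \<equiv> {xs. set xs \<subseteq> {1..n} \<and> length xs = k - 1}"
private abbreviation "L \<equiv> k_mode_unfolding k n (laplacian_tensor k E)"
private abbreviation "deg v \<equiv> vertex_degree E (Suc v)"
private abbreviation "a \<equiv> 1 / fact (k - 1) :: real"

lemma unfolding_carrier: "L \<in> carrier_mat n (n ^ (k - 1))"
  by (simp add: k_mode_unfolding_def)

lemma finite_edges: "finite E"
proof (rule finite_subset)
  show "E \<subseteq> Pow {1..n}" using E by (auto simp: uniform_hypergraph_def)
qed simp

lemma bij_unfolding_column: "bij_betw (unfolding_column k n) {..<n ^ (k - 1)} index_lists"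
  unfolding unfolding_column_def by (rule bij_betw_digits) (use k kn in simp)

text \<open>A constant column tuple has length at least 2 because \<open>k \<ge> 3\<close>, so it
  never carries an adjacency entry. For ordinary graphs this fails, as the tuple has length
  1.\<close>

lemma not_distinct_replicate: "\<not> distinct (replicate (k - 1) x)"
proof -
  have "k - 1 = Suc (Suc (k - 3))" using k by simp
  then show ?thesis by simp
qed

lemma laplacian_tensor_snoc:
  assumes "length xs = k - 1"
  shows "laplacian_tensor k E (xs @ [v]) =
    (if xs = replicate (k - 1) v then real (vertex_degree E v)
     else if distinct (xs @ [v]) \<and> insert v (set xs) \<in> E then - a else 0)"
proof -
  obtain l where l: "k = Suc (Suc (Suc l))" using k by (metis Suc_le_D numeral_3_eq_3 Suc_le_mono)
  have ne: "xs \<noteq> []" using assms l by auto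
  have "xs @ [v] = replicate k (hd (xs @ [v])) \<longleftrightarrow> xs = replicate (k - 1) v"
  proof
    assume eq: "xs @ [v] = replicate k (hd (xs @ [v]))"
    have "replicate k (hd xs) = replicate (k - 1) (hd xs) @ [hd xs]"
      using k by (metis Suc_diff_1 less_le_trans replicate_Suc replicate_append_same zero_less_numeral)
    then show "xs = replicate (k - 1) v" using eq ne by simp
  next
    assume eq: "xs = replicate (k - 1) v"
    then have "hd (xs @ [v]) = v" using ne l by simp
    moreover have "replicate k v = replicate (k - 1) v @ [v]"
      using k by (metis Suc_diff_1 less_le_trans replicate_Suc replicate_append_same zero_less_numeral)
    ultimately show "xs @ [v] = replicate k (hd (xs @ [v]))" using eq by simp
  qed
  moreover have "hd (replicate (k - 1) v @ [v]) = v" using l by simp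
  ultimately show ?thesis
    unfolding laplacian_tensor_def degree_tensor_def adjacency_tensor_def using not_distinct_replicate by auto
qed

lemma unfolding_entry:
  assumes "v < n" "c < n ^ (k - 1)"
  shows "L $$ (v,c) = laplacian_tensor k E (unfolding_column k n c @ [Suc v])"
  using assms by (simp add: k_mode_unfolding_def)

lemma length_unfolding_column: "length (unfolding_column k n c) = k - 1"
  by (simp add: unfolding_column_def)

text \<open>Each edge through the vertex contributes the \<open>(k - 1)!\<close> orderings of its
  other vertices, and different edges give different lists.\<close>

lemma card_link_lists:
  assumes "v < n"
  shows "card {xs \<in> index_lists. distinct (xs @ [Suc v]) \<and> insert (Suc v) (set xs) \<in> E}
    = deg v * fact (k - 1)"
proof -
  let ?I = "{e \<in> E. Suc v \<in> e}" and ?P = "\<lambda>e. permutations_of_set (e - {Suc v})"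
  have e: "e \<subseteq> {1..n}" "card e = k" "finite e" if "e \<in> E" for e
    using E that finite_subset[of e "{1..n}"] by (auto simp: uniform_hypergraph_def)
  have "{xs \<in> index_lists. distinct (xs @ [Suc v]) \<and> insert (Suc v) (set xs) \<in> E}
      = (\<Union>e\<in>?I. ?P e)" (is "?A = ?B")
  proof (intro equalityI subsetI)
    fix xs assume "xs \<in> ?A"
    then have "insert (Suc v) (set xs) \<in> ?I" "xs \<in> ?P (insert (Suc v) (set xs))"
      by (auto simp: permutations_of_set_def)
    then show "xs \<in> ?B" by blast
  next
    fix xs assume "xs \<in> ?B"
    then obtain e' where e': "e' \<in> E" "Suc v \<in> e'" "set xs = e' - {Suc v}" "distinct xs"
      by (auto simp: permutations_of_set_def)
    then have "length xs = k - 1" using e[OF e'(1)] distinct_card[OF e'(4)] by simp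
    moreover have "insert (Suc v) (set xs) = e'" using e' by auto
    ultimately show "xs \<in> ?A" using e' e(1)[OF e'(1)] by auto
  qed
  also have "card \<dots> = (\<Sum>e\<in>?I. card (?P e))"
  proof (rule card_UN_disjoint)
    show "\<forall>i\<in>?I. \<forall>j\<in>?I. i \<noteq> j \<longrightarrow> ?P i \<inter> ?P j = {}"
      by (auto simp: permutations_of_set_def)
  qed (use finite_edges in auto)
  also have "\<dots> = (\<Sum>e\<in>?I. fact (k - 1))"
    by (rule sum.cong) (use e in auto)
  finally show ?thesis by (simp add: vertex_degree_def)
qed

text \<open>One diagonal entry contributes the squared degree; the link lists contribute
  \<open>deg v * fact (k - 1)\<close> entries of square \<open>a^2\<close>.\<close>

lemma sum_row_squares:
  assumes v: "v < n"
  shows "(\<Sum>c<n ^ (k - 1). (L $$ (v,c))\<^sup>2) = (real (deg v))\<^sup>2 + a * real (deg v)"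
proof -
  let ?T = "\<lambda>xs. laplacian_tensor k E (xs @ [Suc v])" and ?r = "replicate (k - 1) (Suc v)"
  let ?A = "{xs \<in> index_lists. distinct (xs @ [Suc v]) \<and> insert (Suc v) (set xs) \<in> E}"
  have fin: "finite index_lists" by (simp add: finite_lists_length_eq)
  have finA: "finite ?A" by (rule finite_subset[OF _ fin]) auto
  have r: "?r \<in> index_lists" using v by auto
  have rA: "?r \<notin> ?A" using k by simp
  have "(\<Sum>c<n ^ (k - 1). (L $$ (v,c))\<^sup>2) = (\<Sum>c<n ^ (k - 1). (?T (unfolding_column k n c))\<^sup>2)"
    by (simp add: unfolding_entry v)
  also have "\<dots> = (\<Sum>xs\<in>index_lists. (?T xs)\<^sup>2)"
    by (rule sum.reindex_bij_betw[OF bij_unfolding_column])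
  \<comment> \<open>Away from the diagonal tuple and the link lists the row vanishes.\<close>
  also have "\<dots> = (\<Sum>xs\<in>insert ?r ?A. (?T xs)\<^sup>2)"
    by (rule sum.mono_neutral_right) (use fin r in \<open>auto simp: laplacian_tensor_snoc\<close>)
  also have "\<dots> = (?T ?r)\<^sup>2 + (\<Sum>xs\<in>?A. (?T xs)\<^sup>2)"
    using finA rA by (subst sum.insert) auto
  also have "(\<Sum>xs\<in>?A. (?T xs)\<^sup>2) = (\<Sum>xs\<in>?A. a\<^sup>2)"
    using rA by (intro sum.cong refl) (auto simp: laplacian_tensor_snoc)
  also have "\<dots> = real (deg v * fact (k - 1)) * a\<^sup>2" by (simp only: sum_constant card_link_lists[OF v])
  also have "\<dots> = a * real (deg v)" by (simp add: power2_eq_square)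
  also have "?T ?r = real (deg v)" by (simp add: laplacian_tensor_snoc)
  finally show ?thesis .
qed

text \<open>If two edges arise from the same tuple by adding \<open>v\<close> and \<open>w\<close>, the second one misses \<open>v\<close>.\<close>

lemma nonzero_column_unique:
  assumes v: "v < n" and w: "w < n" "w \<noteq> v" and c: "c < n ^ (k - 1)"
    and full: "deg v = card E" and nz: "L $$ (v,c) \<noteq> 0"
  shows "L $$ (w,c) = 0"
proof (rule ccontr)
  let ?xs = "unfolding_column k n c"
  assume nzw: "L $$ (w,c) \<noteq> 0"
  have inE: "Suc v \<in> e" if "e \<in> E" for e
  proof -
    have "{e \<in> E. Suc v \<in> e} = E"
      using finite_edges full by (intro card_subset_eq) (auto simp: vertex_degree_def)
    with that show ?thesis by auto
  qed
  show False
    using nz nzw inE w length_unfolding_column[of c] k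
    unfolding unfolding_entry[OF v c] unfolding_entry[OF w(1) c]
    by (auto simp: laplacian_tensor_snoc not_distinct_replicate[simplified] split: if_splits)
qed

text \<open>The witness is the column of the constant tuple with value \<open>Suc v\<close>, where
  every other row is zero because the tuple is not distinct. Degree zero is split off, since private
  columns need a nonzero entry.\<close>

lemma private_columns_ge_degree:
  assumes v: "v < n"
  shows "(real (deg v))\<^sup>2 \<le> (\<Sum>c\<in>private_columns L v. (L $$ (v,c))\<^sup>2)"
proof (cases "deg v = 0")
  case True
  then show ?thesis by (simp add: sum_nonneg)
next
  case False
  let ?r = "replicate (k - 1) (Suc v)"
  have "?r \<in> index_lists" using v by auto
  then obtain c where c: "c < n ^ (k - 1)" and cr: "unfolding_column k n c = ?r"
    using bij_unfolding_column unfolding bij_betw_def by (metis (lifting) imageE lessThan_iff)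
  have Lv: "L $$ (v,c) = real (deg v)"
    by (simp add: unfolding_entry[OF v c] cr laplacian_tensor_snoc)
  have "L $$ (u,c) = 0" if "u < n" "u \<noteq> v" for u
    using that k
    by (auto simp: unfolding_entry[OF that(1) c] cr laplacian_tensor_snoc not_distinct_replicate[simplified])
  then have "c \<in> private_columns L v"
    using Lv False c by (simp add: private_columns_def k_mode_unfolding_def)
  moreover have "finite (private_columns L v)" by (simp add: private_columns_def)
  ultimately have "(\<Sum>c\<in>{c}. (L $$ (v,c))\<^sup>2) \<le> (\<Sum>c\<in>private_columns L v. (L $$ (v,c))\<^sup>2)"
    by (intro sum_mono2) auto
  then show ?thesis by (simp add: Lv)
qed

text \<open>For a vertex in all edges every column outside the private set has entry zero in row
  \<open>v\<close>, so the whole row norm is available.\<close>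

lemma private_columns_full:
  assumes v: "v < n" and full: "deg v = card E"
  shows "(\<Sum>c\<in>private_columns L v. (L $$ (v,c))\<^sup>2) = (real (deg v))\<^sup>2 + a * real (deg v)"
  unfolding sum_row_squares[OF v, symmetric]
proof (rule sum.mono_neutral_left)
  have dims: "dim_row L = n" "dim_col L = n ^ (k - 1)" using unfolding_carrier by auto
  show "private_columns L v \<subseteq> {..<n ^ (k - 1)}" by (auto simp: private_columns_def dims)
  show "\<forall>c\<in>{..<n ^ (k - 1)} - private_columns L v. (L $$ (v,c))\<^sup>2 = 0"
    using nonzero_column_unique[OF v _ _ _ full] by (auto simp: private_columns_def dims)
qed simp

section \<open>The lower bound for an arbitrary hypergraph\<close>

text \<open>Double counting of vertex-edge incidences.\<close>

lemma sum_degrees: "(\<Sum>v<n. deg v) = k * card E"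
proof -
  have "(\<Sum>v<n. deg v) = (\<Sum>v<n. \<Sum>e\<in>E. if Suc v \<in> e then 1 else 0)"
    using finite_edges by (simp add: vertex_degree_def sum.If_cases Int_def)
  also have "\<dots> = (\<Sum>e\<in>E. \<Sum>v<n. if Suc v \<in> e then 1 else 0)" by (rule sum.swap)
  also have "\<dots> = (\<Sum>e\<in>E. k)"
  proof (rule sum.cong)
    fix e assume "e \<in> E"
    then have e: "e \<subseteq> {1..n}" "card e = k" using E by (auto simp: uniform_hypergraph_def)
    have "Suc ` {v. v < n \<and> Suc v \<in> e} = e"
    proof (intro equalityI subsetI)
      fix x assume "x \<in> e"
      then show "x \<in> Suc ` {v. v < n \<and> Suc v \<in> e}" using e(1) by (cases x) auto
    qed auto
    then have "card {v. v < n \<and> Suc v \<in> e} = k"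
      using e(2) by (metis card_image inj_Suc)
    then show "(\<Sum>v<n. if Suc v \<in> e then 1 else 0) = k"
      by (simp add: sum.If_cases Int_def)
  qed simp
  finally show ?thesis by simp
qed

text \<open>The vertices split into the set \<open>F\<close> of those in every edge and the rest
  \<open>R\<close>. Rows in \<open>F\<close> contribute their full norm \<open>s\<close>, rows in
  \<open>R\<close> only their degree; the loss on \<open>R\<close> is covered by the gap between
  those degrees and \<open>m\<close>.\<close>

lemma tensor_entropy_ge:
  assumes ne: "E \<noteq> {}"
  shows "ln (real k) \<le> tensor_entropy k n E"
proof -
  define m where "m = real (card E)"
  define s where "s = sqrt (m\<^sup>2 + a * m)"
  define d where "d v = real (deg v)" for v
  define F where "F = {v. v < n \<and> deg v = card E}"
  define R where "R = {..<n} - F"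
  define t where "t = real (card F)"
  define p where "p v = (if v \<in> F then s else d v)" for v
  have m1: "m \<ge> 1" using ne finite_edges by (simp add: m_def Suc_le_eq card_gt_0_iff)
  have a0: "a > 0" by simp
  \<comment> \<open>Needed for the mixed term of the quadratic comparison below.\<close>
  have a2: "a \<le> 1/2"
  proof -
    have "(2::real) = fact 2" by simp
    also have "\<dots> \<le> fact (k - 1)" by (rule fact_mono) (use k in simp)
    finally show ?thesis by (simp add: field_simps)
  qed
  have ss: "s\<^sup>2 = m\<^sup>2 + a * m" using m1 by (simp add: s_def)
  have sm: "s \<ge> m" unfolding s_def by (rule real_le_rsqrt) (use m1 in simp)
  have dm: "d v \<le> m" for v
    unfolding d_def m_def vertex_degree_def using finite_edges by (simp add: card_mono)
  have dF: "d v = m" if "v \<in> F" for v using that by (simp add: F_def d_def m_def)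
  \<comment> \<open>Degrees are integers, so missing the maximum costs at least one.\<close>
  have dR: "d v \<le> m - 1" if "v \<in> R" for v
    using that dm[of v] by (auto simp: R_def F_def d_def m_def)
  have finF: "finite F" by (simp add: F_def)
  have split: "(\<Sum>v<n. g v) = (\<Sum>v\<in>F. g v) + (\<Sum>v\<in>R. g v)" for g :: "nat \<Rightarrow> real"
    unfolding R_def by (rule trans[OF sum.subset_diff[of F]]) (auto simp: F_def)
  have "(\<Sum>v<n. d v) = k * m"
    unfolding d_def m_def using sum_degrees by (metis of_nat_mult of_nat_sum)
  then have sumR: "(\<Sum>v\<in>R. d v) = (k - t) * m"
    unfolding split by (simp add: dF t_def algebra_simps)
  \<comment> \<open>At most \<open>k\<close> vertices lie in all edges, since they already use
    \<open>t * m\<close> of the \<open>k * m\<close> incidences.\<close>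
  have "0 \<le> (\<Sum>v\<in>R. d v)" by (intro sum_nonneg) (simp add: d_def)
  then have tk: "t \<le> k" using m1 unfolding sumR by (simp add: zero_le_mult_iff)
  have sump: "(\<Sum>v<n. p v) = t * s + (k - t) * m"
    unfolding split sumR[symmetric] by (simp add: p_def t_def R_def)
  have pp: "(\<Sum>v<n. p v) \<le> sum_mset (singular_values L)"
  proof (rule sum_singular_values_ge[OF unfolding_carrier])
    fix v assume v: "v < n"
    show "(p v)\<^sup>2 \<le> (\<Sum>c\<in>private_columns L v. (L $$ (v,c))\<^sup>2)"
    proof (cases "v \<in> F")
      case True
      then show ?thesis using private_columns_full[OF v] ss by (simp add: p_def F_def m_def)
    qed (use private_columns_ge_degree[OF v] in \<open>simp add: p_def d_def\<close>)
  qed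
  define Q where "Q = (\<Sum>\<gamma>\<in>#singular_values L. \<gamma>\<^sup>2)"
  have "Q = (\<Sum>v<n. (d v)\<^sup>2 + a * d v)"
    unfolding Q_def sum_singular_values_squared[OF unfolding_carrier]
    by (intro sum.cong refl) (simp only: sum_row_squares d_def lessThan_iff)
  also have "\<dots> = t * s\<^sup>2 + (\<Sum>v\<in>R. (d v)\<^sup>2 + a * d v)"
    unfolding split by (simp add: dF t_def ss)
  also have "(\<Sum>v\<in>R. (d v)\<^sup>2 + a * d v) \<le> (\<Sum>v\<in>R. (m - 1 + a) * d v)"
    using dR by (intro sum_mono)
      (auto simp: power2_eq_square distrib_right d_def intro: mult_right_mono)
  also have "\<dots> = (m - 1 + a) * ((k - t) * m)" by (simp only: sum_distrib_left[symmetric] sumR)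
  finally have sq_le: "Q \<le> t * s\<^sup>2 + (m - 1 + a) * ((k - t) * m)"
    by simp
  have t0: "t \<ge> 0" by (simp add: t_def)
  \<comment> \<open>With \<open>k = t + q\<close> both sides become quadratic forms in the
    nonnegative \<open>t\<close> and \<open>q\<close>, and can be compared coefficient by
    coefficient.\<close>
  define q where "q = k - t"
  have q0: "q \<ge> 0" using tk by (simp add: q_def)
  have "k * Q \<le> (t + q) * (t * s\<^sup>2 + (m - 1 + a) * (q * m))"
    using sq_le by (simp add: q_def mult_left_mono)
  also have "\<dots> = t\<^sup>2 * s\<^sup>2 + t * q * (s\<^sup>2 + (m - 1 + a) * m) + q\<^sup>2 * ((m - 1 + a) * m)"
    by (simp add: algebra_simps power2_eq_square add_divide_distrib)
  also have "\<dots> \<le> t\<^sup>2 * s\<^sup>2 + t * q * (2 * s * m) + q\<^sup>2 * (m * m)"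
  proof (intro add_mono mult_left_mono mult_right_mono)
    \<comment> \<open>The coefficient of \<open>t * q\<close>: the \<open>- m\<close> gained from
      the degree gap absorbs the two terms \<open>a * m\<close>.\<close>
    have "s\<^sup>2 + (m - 1 + a) * m = 2 * m * m + (2 * a - 1) * m"
      unfolding ss by (simp add: power2_eq_square left_diff_distrib distrib_right)
    also have "\<dots> \<le> 2 * m * m" using a2 m1 by (simp add: mult_nonpos_nonneg)
    also have "\<dots> \<le> 2 * s * m" using sm m1 by simp
    finally show "s\<^sup>2 + (m - 1 + a) * m \<le> 2 * s * m" .
  qed (use t0 q0 a2 m1 in auto)
  also have "\<dots> = (t * s + q * m)\<^sup>2" by (simp add: algebra_simps power2_eq_square)
  also have "\<dots> \<le> (sum_mset (singular_values L))\<^sup>2"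
    using pp t0 q0 m1 sm unfolding sump q_def[symmetric] by (intro power_mono) auto
  finally have coll: "k * Q \<le> (sum_mset (singular_values L))\<^sup>2" .
  have "0 < k * m" using m1 k by simp
  also have "k * m = t * m + q * m" by (simp add: q_def algebra_simps)
  also have "\<dots> \<le> t * s + q * m" using sm t0 by (simp add: mult_left_mono)
  finally have "0 < t * s + q * m" .
  then have "0 < sum_mset (singular_values L)" using pp unfolding sump q_def by (rule less_le_trans)
  moreover have "0 < real k" using k by simp
  ultimately show ?thesis
    unfolding tensor_entropy_def
    by (intro normalized_entropy_ge singular_values_nonneg[OF unfolding_carrier] coll[unfolded Q_def])
qed

end

section \<open>A single edge attains the bound\<close>

lemma normalized_entropy_uniform:
  assumes "s > 0" and "k > 0"
  shows "normalized_entropy (replicate_mset k s + replicate_mset l 0) = ln (real k)"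
  using assms by (simp add: normalized_entropy_def sum_mset_replicate_mset ln_div ln_mult)

text \<open>All \<open>k\<close> vertices of the only edge have full degree, so the rows of the
  unfolding have disjoint supports and the Gram matrix is diagonal.\<close>

lemma tensor_entropy_single_edge:
  assumes k: "k \<ge> 3" and kn: "n \<ge> k"
  shows "uniform_hypergraph k n {{1..k}}" and "tensor_entropy k n {{1..k}} = ln (real k)"
proof -
  let ?E = "{{1..k}}"
  let ?L = "k_mode_unfolding k n (laplacian_tensor k ?E)"
  let ?N = "n ^ (k - 1)"
  \<comment> \<open>The squared norm of the row of a vertex in the edge, whose degree is
    one.\<close>
  define b :: real where "b = 1 + 1 / fact (k - 1)"
  show E: "uniform_hypergraph k n ?E" using kn by (simp add: uniform_hypergraph_def)
  note facts = k kn E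
  have L: "?L \<in> carrier_mat n ?N" by (rule unfolding_carrier[OF facts])
  have deg: "vertex_degree ?E (Suc v) = (if v < k then 1 else 0)" for v
  proof -
    have "{e \<in> ?E. Suc v \<in> e} = (if v < k then {{1..k}} else {})" by auto
    then show ?thesis by (simp add: vertex_degree_def)
  qed
  have sq: "(\<Sum>c<?N. (?L $$ (v,c))\<^sup>2) = (if v < k then b else 0)" if "v < n" for v
    unfolding sum_row_squares[OF facts that] deg by (simp add: b_def)
  \<comment> \<open>For \<open>v < k\<close> the nonzero columns of row \<open>v\<close> are private
    to it; for other \<open>v\<close> the whole row is zero.\<close>
  have orth: "?L $$ (v,c) * ?L $$ (w,c) = 0" if "v < n" "w < n" "v \<noteq> w" "c < ?N" for v w c
  proof (cases "v < k")
    case True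
    then show ?thesis using nonzero_column_unique[OF facts that(1,2) that(3)[symmetric] that(4)] deg by auto
  next
    case False
    then have "(\<Sum>c<?N. (?L $$ (v,c))\<^sup>2) = 0" using sq that by simp
    then show ?thesis using that(4) by (simp add: sum_nonneg_eq_0_iff)
  qed
  have "?L * transpose_mat ?L = mat_diag n (\<lambda>v. if v < k then b else 0)"
  proof (rule eq_matI)
    fix v w assume "v < dim_row (mat_diag n (\<lambda>v. if v < k then b else 0))"
      "w < dim_col (mat_diag n (\<lambda>v. if v < k then b else 0))"
    then have vw: "v < n" "w < n" by (auto simp: mat_diag_def)
    have "(?L * transpose_mat ?L) $$ (v,w) = (\<Sum>c<?N. ?L $$ (v,c) * ?L $$ (w,c))"
      using L vw by (simp add: scalar_prod_def lessThan_atLeast0)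
    also have "\<dots> = mat_diag n (\<lambda>v. if v < k then b else 0) $$ (v,w)"
    proof (cases "v = w")
      case True
      then show ?thesis using vw sq[OF vw(1)] by (simp add: mat_diag_def power2_eq_square)
    next
      case False
      then have "(\<Sum>c<?N. ?L $$ (v,c) * ?L $$ (w,c)) = 0"
        using orth[OF vw] by (intro sum.neutral) auto
      then show ?thesis using vw False by (simp add: mat_diag_def)
    qed
    finally show "(?L * transpose_mat ?L) $$ (v,w) = mat_diag n (\<lambda>v. if v < k then b else 0) $$ (v,w)" .
  qed (use L in \<open>auto simp: mat_diag_def\<close>)
  then have "singular_values ?L = image_mset sqrt (mset (map (\<lambda>v. if v < k then b else 0) [0..<n]))"
    unfolding singular_values_def by (simp only: char_poly_mat_diag proots_prod_linear)
  also have "map (\<lambda>v. if v < k then b else 0) [0..<n] = replicate k b @ replicate (n - k) 0"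
    using kn by (intro nth_equalityI) (auto simp: nth_append)
  also have "image_mset sqrt (mset \<dots>) = replicate_mset k (sqrt b) + replicate_mset (n - k) 0"
    by (simp add: image_replicate_mset)
  finally have "tensor_entropy k n ?E = normalized_entropy (replicate_mset k (sqrt b) + replicate_mset (n - k) 0)"
    by (simp add: tensor_entropy_def)
  then show "tensor_entropy k n ?E = ln (real k)"
    using k by (simp add: normalized_entropy_uniform b_def add_pos_pos)
qed

theorem proposition1:
  fixes k n :: nat
  assumes "k \<ge> 3" and "n \<ge> k"
  shows "(\<exists>E. uniform_hypergraph k n E \<and> E \<noteq> {} \<and> tensor_entropy k n E = ln (real k))
    \<and> (\<forall>E. uniform_hypergraph k n E \<and> E \<noteq> {} \<longrightarrow> ln (real k) \<le> tensor_entropy k n E)"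
  using tensor_entropy_single_edge[OF assms] tensor_entropy_ge[OF assms] by blast

end
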